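(* Let $n,m\ge 5$ be integers with $m\equiv 1\pmod 4$ and $n\equiv 3\pmod 4$. Then $\gamma_t(C_n\times C_m)\le\frac{(n+1)(m+1)}{4}-3$ and $\gamma_p(C_n\times C_m)\le\frac{(n+1)(m+1)}{4}-2$.
   Context: All graphs are finite, simple and undirected. $C_n$ denotes the cycle of order $n$ and $G\times H$ the Cartesian product of graphs. For a graph $G$ without isolated vertices: a set $D\subseteq V(G)$ is a total dominating set if every vertex of $G$ (including those in $D$) has a neighbour in $D$; $\gamma_t(G)$ is the minimum size of a total dominating set. A set $D\subseteq V(G)$ is a paired dominating set if every vertex outside $D$ has a neighbour in $D$ and the induced subgraph $G[D]$ has a perfect matching; $\gamma_p(G)$ is the minimum size of a paired dominating set. *)

theory Defs
  imports Complex_Main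
begin

text \<open>A finite simple graph is given by a vertex set V and a symmetric irreflexive
adjacency relation E (only its restriction to V matters).\<close>

definition cycle_adj :: "nat \<Rightarrow> nat \<Rightarrow> nat \<Rightarrow> bool" where
  "cycle_adj n i j \<longleftrightarrow> i < n \<and> j < n \<and> i \<noteq> j \<and> (j = (i + 1) mod n \<or> i = (j + 1) mod n)"

definition cyc_prod_V :: "nat \<Rightarrow> nat \<Rightarrow> (nat \<times> nat) set" where
  "cyc_prod_V n m = {0..<n} \<times> {0..<m}"

definition cyc_prod_adj :: "nat \<Rightarrow> nat \<Rightarrow> nat \<times> nat \<Rightarrow> nat \<times> nat \<Rightarrow> bool" where
  "cyc_prod_adj n m u v \<longleftrightarrow>
     (fst u = fst v \<and> fst u < n \<and> cycle_adj m (snd u) (snd v)) \<or>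
     (snd u = snd v \<and> snd u < m \<and> cycle_adj n (fst u) (fst v))"

definition total_dominating :: "'a set \<Rightarrow> ('a \<Rightarrow> 'a \<Rightarrow> bool) \<Rightarrow> 'a set \<Rightarrow> bool" where
  "total_dominating V E D \<longleftrightarrow> D \<subseteq> V \<and> (\<forall>v\<in>V. \<exists>u\<in>D. E v u)"

definition total_domination_number :: "'a set \<Rightarrow> ('a \<Rightarrow> 'a \<Rightarrow> bool) \<Rightarrow> nat" where
  "total_domination_number V E = Min (card ` {D. total_dominating V E D})"

definition perfect_matching_on :: "('a \<Rightarrow> 'a \<Rightarrow> bool) \<Rightarrow> 'a set \<Rightarrow> 'a set set \<Rightarrow> bool" where
  "perfect_matching_on E D M \<longleftrightarrow>
     (\<forall>e\<in>M. \<exists>u v. e = {u, v} \<and> u \<in> D \<and> v \<in> D \<and> u \<noteq> v \<and> E u v) \<and>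
     (\<forall>e\<in>M. \<forall>f\<in>M. e \<noteq> f \<longrightarrow> e \<inter> f = {}) \<and>
     \<Union>M = D"

definition paired_dominating :: "'a set \<Rightarrow> ('a \<Rightarrow> 'a \<Rightarrow> bool) \<Rightarrow> 'a set \<Rightarrow> bool" where
  "paired_dominating V E D \<longleftrightarrow> D \<subseteq> V \<and> (\<forall>v\<in>V - D. \<exists>u\<in>D. E v u) \<and>
     (\<exists>M. perfect_matching_on E D M)"

definition paired_domination_number :: "'a set \<Rightarrow> ('a \<Rightarrow> 'a \<Rightarrow> bool) \<Rightarrow> nat" where
  "paired_domination_number V E = Min (card ` {D. paired_dominating V E D})"

end

theory Submission
  imports Defs
begin

text \<open>
  An explicit set in \<open>C\<^sub>7 \<times> C\<^sub>5\<close> is extended to all larger tori of the given residues by inserting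
  blocks of four consecutive rows and four consecutive columns.  It is given by an \<open>11 \<times> 9\<close> pattern
  whose first four rows and columns are the ones to insert, as often as wanted and possibly not at
  all.  Row 4 equals row 0 and row 10 equals row 3, and similarly for the columns, so every vertex of
  the enlarged torus sees the same four neighbours as the corresponding vertex of the \<open>11 \<times> 9\<close> torus.
  Hence domination and matching only have to be verified for the pattern.  The size is
  \<open>4st + 6s + 8t\<close> plus the size for \<open>s = t = 0\<close> if \<open>4s\<close> rows and \<open>4t\<close> columns are inserted.
\<close>

section \<open>Folding positions of an enlarged cycle to pattern indices\<close>

definition fold_idx :: "nat \<Rightarrow> nat \<Rightarrow> nat" where
  "fold_idx s i = (if i < 4 * s then i mod 4 else i + 4 - 4 * s)"

lemma fold_idx_less:
  assumes "i < 4 * s + k"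
  shows "fold_idx s i < k + 4"
proof (cases "i < 4 * s")
  case True
  have "i mod 4 < 4" by simp
  then show ?thesis using True unfolding fold_idx_def by simp
next
  case False
  then show ?thesis using assms unfolding fold_idx_def by simp
qed

definition cyc_succ :: "nat \<Rightarrow> nat \<Rightarrow> nat" where
  "cyc_succ n i = (i + 1) mod n"

definition cyc_pred :: "nat \<Rightarrow> nat \<Rightarrow> nat" where
  "cyc_pred n i = (i + (n - 1)) mod n"

lemma cyc_succ_eq: "i < n \<Longrightarrow> cyc_succ n i = (if i + 1 = n then 0 else i + 1)"
  by (auto simp: cyc_succ_def)

lemma cyc_pred_eq:
  assumes "i < n"
  shows "cyc_pred n i = (if i = 0 then n - 1 else i - 1)"
proof (cases "i = 0")
  case True
  then show ?thesis using assms by (simp add: cyc_pred_def)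
next
  case False
  then have "i + (n - 1) = (i - 1) + n" using assms by simp
  then have "cyc_pred n i = (i - 1 + n) mod n" by (simp only: cyc_pred_def)
  also have "\<dots> = i - 1" using assms by (simp only: mod_add_self2 mod_less less_imp_diff_less)
  finally show ?thesis using False by simp
qed

lemma cyc_succ_less: "i < n \<Longrightarrow> cyc_succ n i < n"
  by (simp add: cyc_succ_def)

lemma cyc_pred_less: "i < n \<Longrightarrow> cyc_pred n i < n"
  by (simp add: cyc_pred_def)

lemma cyc_pred_succ: "i < n \<Longrightarrow> cyc_pred n (cyc_succ n i) = i"
  by (auto simp: cyc_succ_eq cyc_pred_eq)

lemma cyc_succ_pred: "i < n \<Longrightarrow> cyc_succ n (cyc_pred n i) = i"
  by (auto simp: cyc_succ_eq cyc_pred_eq)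

text \<open>Here \<open>k\<close> is the length before insertion. Folding commutes with the
  successor only up to \<open>A\<close>: after pattern index 3 another copy of the block may start
  at 0, where the pattern continues with 4. \<open>A\<close> will be the list of rows or a single
  row.\<close>

lemma fold_idx_succ:
  assumes "A 4 = A 0" and "k \<ge> 2" and "i < 4 * s + k"
  shows "A (fold_idx s (cyc_succ (4 * s + k) i)) = A (cyc_succ (k + 4) (fold_idx s i))"
proof -
  have less: "fold_idx s i < k + 4" by (rule fold_idx_less[OF assms(3)])
  consider "i + 1 = 4 * s + k" | "i + 1 < 4 * s + k" "4 * s \<le> i" | "i + 1 = 4 * s" | "i + 1 < 4 * s"
    using assms(3) by linarith
  then show ?thesis
  proof cases
    case 1
    then have "fold_idx s i + 1 = k + 4" using assms(2) by (simp add: fold_idx_def)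
    then have "cyc_succ (k + 4) (fold_idx s i) = 0" by (simp only: cyc_succ_def mod_self)
    moreover have "cyc_succ (4 * s + k) i = 0" using 1 by (simp add: cyc_succ_def)
    \<comment> \<open>Position 0 folds to 0 if a block is inserted, but to 4 if
      \<open>s = 0\<close>.\<close>
    ultimately show ?thesis using assms(1) by (simp add: fold_idx_def)
  next
    case 2
    then have "fold_idx s (i + 1) = fold_idx s i + 1" "fold_idx s i + 1 \<noteq> k + 4"
      by (simp_all add: fold_idx_def Suc_diff_le)
    then show ?thesis using 2 assms(3) less by (simp add: cyc_succ_eq)
  next
    case 3
    then have "i mod 4 = 3" by presburger
    then show ?thesis using 3 assms(2,3) less by (simp add: fold_idx_def cyc_succ_eq)
  next
    case 4
    have "(i + 1) mod 4 = (if i mod 4 = 3 then 0 else i mod 4 + 1)" by (simp add: mod_Suc)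
    then have "A ((i + 1) mod 4) = A (i mod 4 + 1)" using assms(1) by (auto split: if_splits)
    moreover have "i mod 4 + 1 \<noteq> k + 4" using assms(2) mod_less_divisor[of 4 i] by linarith
    ultimately show ?thesis using 4 assms(3) less by (simp add: fold_idx_def cyc_succ_eq)
  qed
qed

text \<open>The block start 0 has predecessor \<open>k + 3\<close> in the pattern, but 3 inside a
  run of copies. If \<open>s = 0\<close>, the roles swap: the first position folds to 4, preceded by
  3 in the pattern but by \<open>k + 3\<close> after folding. \<open>A\<close> hides both
  discrepancies.\<close>

lemma fold_idx_pred:
  assumes "A (k + 3) = A 3" and "k \<ge> 2" and "i < 4 * s + k"
  shows "A (fold_idx s (cyc_pred (4 * s + k) i)) = A (cyc_pred (k + 4) (fold_idx s i))"
proof -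
  have less: "fold_idx s i < k + 4" by (rule fold_idx_less[OF assms(3)])
  have sub: "k + 4 - 1 = k + 3" by simp
  consider "i = 0" | "4 * s < i" | "i = 4 * s" "i \<noteq> 0" | "i < 4 * s" "i \<noteq> 0" by linarith
  then show ?thesis
  proof cases
    case 1
    have "fold_idx s (4 * s + k - 1) = k + 3" using assms(2) by (simp add: fold_idx_def)
    moreover have "A (cyc_pred (k + 4) (fold_idx s 0)) = A (k + 3)"
      using assms(1,2) sub by (cases "s = 0") (simp_all add: fold_idx_def cyc_pred_eq add.commute)
    ultimately show ?thesis using 1 assms(3) by (simp add: cyc_pred_eq)
  next
    case 2
    then have "fold_idx s (i - 1) = fold_idx s i - 1" "fold_idx s i \<noteq> 0"
      by (simp_all add: fold_idx_def)
    then show ?thesis using 2 assms(3) less by (simp add: cyc_pred_eq)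
  next
    case 3
    then obtain u where "s = Suc u" by (cases s) auto
    then have "i - 1 = 3 + u * 4" using 3 by simp
    then have "(i - 1) mod 4 = 3" by (simp only: mod_mult_self1) simp
    then have "fold_idx s (i - 1) = 3" "fold_idx s i = 4" using 3 by (simp_all add: fold_idx_def)
    then show ?thesis using 3 assms(3) less by (simp add: cyc_pred_eq)
  next
    case 4
    have "(i - 1) mod 4 = (if i mod 4 = 0 then 3 else i mod 4 - 1)"
      using 4(2) by (cases i) (auto simp: mod_Suc)
    moreover have "cyc_pred (k + 4) (i mod 4) = (if i mod 4 = 0 then k + 3 else i mod 4 - 1)"
      using less 4 sub cyc_pred_eq[of "i mod 4" "k + 4"] by (simp add: fold_idx_def)
    ultimately have "A ((i - 1) mod 4) = A (cyc_pred (k + 4) (i mod 4))"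
      using assms(1) by simp
    moreover have "i - 1 < 4 * s" using 4(1) by simp
    ultimately show ?thesis using 4 assms(3) by (simp add: fold_idx_def cyc_pred_eq[of i])
  qed
qed

text \<open>The positions sweep the block 0..3 \<open>s\<close> times and every later pattern index
  once.\<close>

lemma sum_fold_idx:
  fixes h :: "nat \<Rightarrow> nat"
  shows "(\<Sum>i<4 * s + k. h (fold_idx s i)) = s * (\<Sum>p<4. h p) + (\<Sum>p\<in>{4..<k + 4}. h p)"
proof -
  have split: "(\<Sum>i<a + b. g i) = (\<Sum>i<a. g i) + (\<Sum>i<b. g (a + i))"
    for g :: "nat \<Rightarrow> nat" and a b :: nat
    by (induction b) (simp_all add: add.assoc)
  have 1: "(\<Sum>i<4 * s. h (i mod 4)) = s * (\<Sum>p<4. h p)"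
  proof (induction s)
    case (Suc s)
    have "4 * Suc s = 4 * s + 4" by simp
    then have "(\<Sum>i<4 * Suc s. h (i mod 4)) = (\<Sum>i<4 * s. h (i mod 4)) + (\<Sum>i<4. h ((4 * s + i) mod 4))"
      by (simp only: split)
    also have "(\<Sum>i<4. h ((4 * s + i) mod 4)) = (\<Sum>p<4. h p)" by (rule sum.cong) auto
    finally show ?case using Suc by simp
  qed simp
  have "(\<Sum>i<4 * s + k. h (fold_idx s i))
      = (\<Sum>i<4 * s. h (fold_idx s i)) + (\<Sum>i<k. h (fold_idx s (4 * s + i)))"
    by (rule split)
  also have "(\<Sum>i<4 * s. h (fold_idx s i)) = (\<Sum>i<4 * s. h (i mod 4))"
    by (simp add: fold_idx_def)
  also have "(\<Sum>i<k. h (fold_idx s (4 * s + i))) = (\<Sum>i<k. h (i + 4))"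
    by (simp add: fold_idx_def add.commute)
  also have "\<dots> = (\<Sum>p\<in>{4..<k + 4}. h p)"
    using sum.shift_bounds_nat_ivl[of h 0 4 k] by (simp add: atLeast0LessThan)
  finally show ?thesis using 1 by simp
qed

section \<open>Unit steps on the torus\<close>

datatype dir = North | South | West | East

text \<open>Opposite directions encode a matching locally: a vertex labelled \<open>d\<close> is
  matched along \<open>d\<close>, and its partner must carry the label \<open>opp d\<close>.\<close>

fun opp :: "dir \<Rightarrow> dir" where
  "opp North = South"
| "opp South = North"
| "opp West = East"
| "opp East = West"

fun step :: "nat \<Rightarrow> nat \<Rightarrow> dir \<Rightarrow> nat \<times> nat \<Rightarrow> nat \<times> nat" where
  "step n m North (i, j) = (cyc_pred n i, j)"
| "step n m South (i, j) = (cyc_succ n i, j)"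
| "step n m West (i, j) = (i, cyc_pred m j)"
| "step n m East (i, j) = (i, cyc_succ m j)"

lemma step_in_V:
  assumes "v \<in> cyc_prod_V n m"
  shows "step n m d v \<in> cyc_prod_V n m"
  using assms by (cases v; cases d) (auto simp: cyc_prod_V_def cyc_succ_less cyc_pred_less)

lemma step_opp:
  assumes "v \<in> cyc_prod_V n m"
  shows "step n m (opp d) (step n m d v) = v"
  using assms by (cases v; cases d) (auto simp: cyc_prod_V_def cyc_pred_succ cyc_succ_pred)

lemma cycle_adj_succ:
  assumes "i < n" and "n \<ge> 2"
  shows "cycle_adj n i (cyc_succ n i)"
  using assms cyc_succ_less[OF assms(1)] cyc_succ_eq[OF assms(1)]
  by (auto simp: cycle_adj_def cyc_succ_def)

lemma cycle_adj_pred: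
  assumes "i < n" and "n \<ge> 2"
  shows "cycle_adj n i (cyc_pred n i)"
  using cycle_adj_succ[OF cyc_pred_less[OF assms(1)] assms(2)] cyc_succ_pred[OF assms(1)]
  by (auto simp: cycle_adj_def)

lemma adj_step:
  assumes "v \<in> cyc_prod_V n m" and "n \<ge> 2" and "m \<ge> 2"
  shows "cyc_prod_adj n m v (step n m d v)"
  using assms
  by (cases v; cases d) (auto simp: cyc_prod_V_def cyc_prod_adj_def cycle_adj_succ cycle_adj_pred)

section \<open>Patterns and their enlargement\<close>

fun entry :: "string list \<Rightarrow> nat \<times> nat \<Rightarrow> char" where
  "entry B (p, q) = B ! p ! q"

definition fold_pos :: "nat \<Rightarrow> nat \<Rightarrow> nat \<times> nat \<Rightarrow> nat \<times> nat" where
  "fold_pos s t = map_prod (fold_idx s) (fold_idx t)"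

text \<open>The equalities are the hypotheses on \<open>A\<close> in \<open>fold_idx_succ\<close>
  and \<open>fold_idx_pred\<close>, once for whole rows and once for the entries within each
  row.\<close>

definition pumpable :: "nat \<Rightarrow> nat \<Rightarrow> string list \<Rightarrow> bool" where
  "pumpable k l B \<longleftrightarrow> k \<ge> 2 \<and> l \<ge> 2 \<and> B ! 4 = B ! 0 \<and> B ! (k + 3) = B ! 3 \<and>
     (\<forall>r\<in>{..<k + 4}. B ! r ! 4 = B ! r ! 0 \<and> B ! r ! (l + 3) = B ! r ! 3)"

lemma fold_pos_in_V:
  assumes "v \<in> cyc_prod_V (4 * s + k) (4 * t + l)"
  shows "fold_pos s t v \<in> cyc_prod_V (k + 4) (l + 4)"
  using assms fold_idx_less by (cases v) (auto simp: cyc_prod_V_def fold_pos_def)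

text \<open>Only the entries agree; the two pattern positions may differ at the border of a block.
  Vertical steps compare whole rows, horizontal ones compare entries of one fixed row.\<close>

lemma entry_fold_pos_step:
  assumes B: "pumpable k l B" and v: "v \<in> cyc_prod_V (4 * s + k) (4 * t + l)"
  shows "entry B (fold_pos s t (step (4 * s + k) (4 * t + l) d v))
       = entry B (step (k + 4) (l + 4) d (fold_pos s t v))"
proof -
  obtain i j where v_eq: "v = (i, j)" by (cases v)
  have i: "i < 4 * s + k" and j: "j < 4 * t + l" using v v_eq by (auto simp: cyc_prod_V_def)
  have r: "fold_idx s i < k + 4" by (rule fold_idx_less[OF i])
  have k: "k \<ge> 2" "l \<ge> 2" using B by (auto simp: pumpable_def)
  have row: "B ! 4 = B ! 0" "B ! (k + 3) = B ! 3" using B by (auto simp: pumpable_def)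
  have col: "B ! fold_idx s i ! 4 = B ! fold_idx s i ! 0"
    "B ! fold_idx s i ! (l + 3) = B ! fold_idx s i ! 3"
    using B r by (auto simp: pumpable_def)
  show ?thesis
  proof (cases d)
    case North
    then show ?thesis
      using fold_idx_pred[of "(!) B", OF row(2) k(1) i] v_eq by (simp add: fold_pos_def)
  next
    case South
    then show ?thesis
      using fold_idx_succ[of "(!) B", OF row(1) k(1) i] v_eq by (simp add: fold_pos_def)
  next
    case West
    then show ?thesis
      using fold_idx_pred[of "(!) (B ! fold_idx s i)", OF col(2) k(2) j] v_eq
      by (simp add: fold_pos_def)
  next
    case East
    then show ?thesis
      using fold_idx_succ[of "(!) (B ! fold_idx s i)", OF col(1) k(2) j] v_eq
      by (simp add: fold_pos_def)
  qed
qed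

section \<open>The set read off a pattern, and its size\<close>

definition tiled :: "(char \<Rightarrow> bool) \<Rightarrow> string list \<Rightarrow> nat \<Rightarrow> nat \<Rightarrow> (nat \<times> nat) set \<Rightarrow> (nat \<times> nat) set" where
  "tiled P B s t V = {v \<in> V. P (entry B (fold_pos s t v))}"

definition block_count :: "(char \<Rightarrow> bool) \<Rightarrow> string list \<Rightarrow> nat set \<Rightarrow> nat set \<Rightarrow> nat" where
  "block_count P B I J = (\<Sum>p\<in>I. \<Sum>q\<in>J. of_bool (P (entry B (p, q))))"

text \<open>Folding the sum over columns and then the one over rows splits the pattern into four
  blocks, which occur \<open>s * t\<close>, \<open>s\<close>, \<open>t\<close> and 1 times.\<close>

lemma card_tiled:
  "card (tiled P B s t (cyc_prod_V (4 * s + k) (4 * t + l)))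
     = s * t * block_count P B {..<4} {..<4} + s * block_count P B {..<4} {4..<l + 4}
       + t * block_count P B {4..<k + 4} {..<4} + block_count P B {4..<k + 4} {4..<l + 4}"
proof -
  let ?e = "\<lambda>p q. of_bool (P (entry B (p, q))) :: nat"
  have "card (tiled P B s t (cyc_prod_V (4 * s + k) (4 * t + l)))
      = (\<Sum>v\<in>{..<4 * s + k} \<times> {..<4 * t + l}. of_bool (P (entry B (fold_pos s t v))))"
    by (simp add: tiled_def cyc_prod_V_def atLeast0LessThan Int_def)
  also have "\<dots> = (\<Sum>i<4 * s + k. \<Sum>j<4 * t + l. ?e (fold_idx s i) (fold_idx t j))"
    unfolding sum.cartesian_product by (rule sum.cong) (auto simp: fold_pos_def)
  also have "\<dots> = (\<Sum>i<4 * s + k. t * (\<Sum>q<4. ?e (fold_idx s i) q) + (\<Sum>q\<in>{4..<l + 4}. ?e (fold_idx s i) q))"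
    by (rule sum.cong[OF refl], rule sum_fold_idx)
  also have "\<dots> = s * (\<Sum>p<4. t * (\<Sum>q<4. ?e p q) + (\<Sum>q\<in>{4..<l + 4}. ?e p q))
      + (\<Sum>p\<in>{4..<k + 4}. t * (\<Sum>q<4. ?e p q) + (\<Sum>q\<in>{4..<l + 4}. ?e p q))"
    by (rule sum_fold_idx)
  finally show ?thesis
    by (simp only: block_count_def sum.distrib sum_distrib_left[symmetric] algebra_simps)
qed

section \<open>Domination and matching inherited from a pattern\<close>

definition dominating_pattern :: "(char \<Rightarrow> bool) \<Rightarrow> nat \<Rightarrow> nat \<Rightarrow> string list \<Rightarrow> bool" where
  "dominating_pattern P k l B \<longleftrightarrow>
     (\<forall>p\<in>{..<k + 4}. \<forall>q\<in>{..<l + 4}. \<exists>d\<in>{North, South, West, East}.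
        P (entry B (step (k + 4) (l + 4) d (p, q))))"

lemma total_dominating_tiled:
  assumes "pumpable k l B" and "dominating_pattern P k l B"
    and V: "V = cyc_prod_V (4 * s + k) (4 * t + l)"
  shows "total_dominating V (cyc_prod_adj (4 * s + k) (4 * t + l)) (tiled P B s t V)"
  unfolding total_dominating_def
proof (intro conjI ballI)
  show "tiled P B s t V \<subseteq> V" by (auto simp: tiled_def)
next
  fix v assume v: "v \<in> V"
  let ?st = "\<lambda>d. step (4 * s + k) (4 * t + l) d v"
  have "fold_pos s t v \<in> cyc_prod_V (k + 4) (l + 4)" using v V fold_pos_in_V by blast
  then have "\<exists>d\<in>{North, South, West, East}. P (entry B (step (k + 4) (l + 4) d (fold_pos s t v)))"
    using assms(2) unfolding dominating_pattern_def cyc_prod_V_def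
    by (cases "fold_pos s t v") (auto simp del: step.simps)
  then obtain d where "P (entry B (step (k + 4) (l + 4) d (fold_pos s t v)))" by blast
  then have "?st d \<in> tiled P B s t V"
    using entry_fold_pos_step[OF assms(1)] step_in_V v unfolding V tiled_def by simp
  moreover have "cyc_prod_adj (4 * s + k) (4 * t + l) v (?st d)"
    using adj_step v V assms(1) by (simp add: pumpable_def)
  ultimately show "\<exists>u\<in>tiled P B s t V. cyc_prod_adj (4 * s + k) (4 * t + l) v u" by blast
qed

text \<open>The orbits of a fixed-point-free involution along edges are disjoint edges covering the
  set.\<close>

lemma perfect_matching_on_involution:
  assumes "\<And>v. v \<in> D \<Longrightarrow> f v \<in> D \<and> f (f v) = v \<and> v \<noteq> f v \<and> E v (f v)"
  shows "perfect_matching_on E D ((\<lambda>v. {v, f v}) ` D)"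
  unfolding perfect_matching_on_def
proof (intro conjI ballI impI)
  fix e assume "e \<in> (\<lambda>v. {v, f v}) ` D"
  then obtain v where "v \<in> D" "e = {v, f v}" by blast
  then have "e = {v, f v} \<and> v \<in> D \<and> f v \<in> D \<and> v \<noteq> f v \<and> E v (f v)"
    using assms[of v] by simp
  then show "\<exists>u v. e = {u, v} \<and> u \<in> D \<and> v \<in> D \<and> u \<noteq> v \<and> E u v" by blast
next
  \<comment> \<open>An orbit is determined by either of its endpoints, so two orbits sharing a
    vertex coincide.\<close>
  have block: "e = {x, f x}" if "e \<in> (\<lambda>v. {v, f v}) ` D" "x \<in> e" for e x
  proof -
    obtain v where "v \<in> D" "e = {v, f v}" using \<open>e \<in> _\<close> by blast
    then show ?thesis using \<open>x \<in> e\<close> assms[of v] by auto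
  qed
  fix e g assume "e \<in> (\<lambda>v. {v, f v}) ` D" "g \<in> (\<lambda>v. {v, f v}) ` D" "e \<noteq> g"
  then have False if "x \<in> e" "x \<in> g" for x
    using block[of e x] block[of g x] that by simp
  then show "e \<inter> g = {}" by blast
next
  show "\<Union> ((\<lambda>v. {v, f v}) ` D) = D" using assms by auto
qed

definition arrow :: "char \<Rightarrow> dir option" where
  "arrow c = (if c = CHR ''N'' then Some North else if c = CHR ''S'' then Some South
     else if c = CHR ''W'' then Some West else if c = CHR ''E'' then Some East else None)"

definition is_arrow :: "char \<Rightarrow> bool" where
  "is_arrow c \<longleftrightarrow> arrow c \<noteq> None"

definition matching_pattern :: "nat \<Rightarrow> nat \<Rightarrow> string list \<Rightarrow> bool" where
  "matching_pattern k l B \<longleftrightarrow>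
     (\<forall>p\<in>{..<k + 4}. \<forall>q\<in>{..<l + 4}. case arrow (entry B (p, q)) of None \<Rightarrow> True
        | Some d \<Rightarrow> arrow (entry B (step (k + 4) (l + 4) d (p, q))) = Some (opp d))"

lemma paired_dominating_tiled:
  assumes B: "pumpable k l B" and dom: "dominating_pattern is_arrow k l B"
    and match: "matching_pattern k l B" and V: "V = cyc_prod_V (4 * s + k) (4 * t + l)"
  shows "paired_dominating V (cyc_prod_adj (4 * s + k) (4 * t + l))
    (tiled is_arrow B s t V)"
proof -
  let ?D = "tiled is_arrow B s t V"
  let ?E = "cyc_prod_adj (4 * s + k) (4 * t + l)"
  let ?st = "step (4 * s + k) (4 * t + l)"
  define lab where "lab v = arrow (entry B (fold_pos s t v))" for v
  define f where "f v = ?st (the (lab v)) v" for v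
  have mem: "v \<in> ?D \<longleftrightarrow> v \<in> V \<and> lab v \<noteq> None" for v by (simp add: tiled_def lab_def is_arrow_def)
  have "f v \<in> ?D \<and> f (f v) = v \<and> v \<noteq> f v \<and> ?E v (f v)" if "v \<in> ?D" for v
  proof -
    have v: "v \<in> V" and "lab v \<noteq> None" using that mem by blast+
    then obtain d where d: "lab v = Some d" by blast
    obtain p q where pq: "fold_pos s t v = (p, q)" by fastforce
    then have "p < k + 4" "q < l + 4"
      using v V fold_pos_in_V[of v s k t l] by (auto simp: cyc_prod_V_def)
    then have "case lab v of None \<Rightarrow> True
        | Some d \<Rightarrow> arrow (entry B (step (k + 4) (l + 4) d (fold_pos s t v))) = Some (opp d)"
      using bspec[OF bspec[OF match[unfolded matching_pattern_def], of p], of q]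
      by (simp only: lessThan_iff lab_def pq)
    then have "arrow (entry B (step (k + 4) (l + 4) d (fold_pos s t v))) = Some (opp d)"
      using d by simp
    \<comment> \<open>The label at the partner in the enlarged torus equals the one at the neighbour
      in the pattern, so the partner points back.\<close>
    then have lab_f: "lab (f v) = Some (opp d)"
      using entry_fold_pos_step[OF B] v V d by (simp add: lab_def f_def)
    have f_v: "f v = ?st d v" by (simp add: f_def d)
    have "f (f v) = ?st (opp d) (f v)" by (simp add: f_def[of "f v"] lab_f)
    then have "f (f v) = v" using step_opp v V unfolding f_v by simp
    moreover have "f v \<in> ?D" using step_in_V v V lab_f mem f_v by simp
    moreover have adj: "?E v (f v)" using adj_step v V B f_v by (simp add: pumpable_def)
    moreover have "v \<noteq> f v"
    proof
      assume "v = f v"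
      then have "?E v v" using adj by simp
      then show False by (simp add: cyc_prod_adj_def cycle_adj_def)
    qed
    ultimately show ?thesis by blast
  qed
  then have "perfect_matching_on ?E ?D ((\<lambda>v. {v, f v}) ` ?D)"
    by (rule perfect_matching_on_involution)
  then have "\<exists>M. perfect_matching_on ?E ?D M" ..
  \<comment> \<open>Total domination covers in particular the vertices outside the set.\<close>
  moreover have "total_dominating V ?E ?D" by (rule total_dominating_tiled[OF B dom V])
  ultimately show ?thesis by (simp add: total_dominating_def paired_dominating_def)
qed

section \<open>Any explicit set bounds the domination number\<close>

lemma total_domination_number_le:
  assumes "finite V" and "total_dominating V E D"
  shows "total_domination_number V E \<le> card D"
proof -
  have "{D. total_dominating V E D} \<subseteq> Pow V" by (auto simp: total_dominating_def)
  then have "finite {D. total_dominating V E D}" using assms(1) by (simp add: finite_subset)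
  then show ?thesis using assms(2) by (simp add: total_domination_number_def)
qed

lemma paired_domination_number_le:
  assumes "finite V" and "paired_dominating V E D"
  shows "paired_domination_number V E \<le> card D"
proof -
  have "{D. paired_dominating V E D} \<subseteq> Pow V" by (auto simp: paired_dominating_def)
  then have "finite {D. paired_dominating V E D}" using assms(1) by (simp add: finite_subset)
  then show ?thesis using assms(2) by (simp add: paired_domination_number_def)
qed

section \<open>The two concrete patterns\<close>

text \<open>Both patterns were found by a SAT solver.\<close>

definition total_pattern :: "string list" where
  "total_pattern =
    [''..#....#.'',
     ''#...##...'',
     ''#...##...'',
     ''..#....#.'',
     ''..#....#.'',
     ''##..##...'',
     ''.........'',
     ''..##..###'',
     ''.........'',
     ''##..##...'',
     ''..#....#.'']"

text \<open>Each letter points to the partner of the vertex in the matching.\<close>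

definition paired_pattern :: "string list" where
  "paired_pattern =
    [''...S....S'',
     ''...N....N'',
     ''.S...EW..'',
     ''.N...EW..'',
     ''...S....S'',
     ''...N....N'',
     ''.S...EW..'',
     ''.N...EW..'',
     ''...S....S'',
     ''.S.N....N'',
     ''.N...EW..'']"

text \<open>All quantifiers range over finite sets, so evaluation decides the claims. The parameters
  7 and 5 are the side lengths without insertions.\<close>

lemma total_pattern_check:
  "pumpable 7 5 total_pattern"
  "dominating_pattern (\<lambda>c. c = CHR ''#'') 7 5 total_pattern"
  by code_simp+

text \<open>The inserted 4 by 4 block has density 1/4, optimal in a 4-regular graph. The last count
  is the size in the 7 by 5 torus, 12 - 3.\<close>

lemma total_pattern_count:
  "block_count (\<lambda>c. c = CHR ''#'') total_pattern {..<4} {..<4} = 4"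
  "block_count (\<lambda>c. c = CHR ''#'') total_pattern {..<4} {4..<9} = 6"
  "block_count (\<lambda>c. c = CHR ''#'') total_pattern {4..<11} {..<4} = 8"
  "block_count (\<lambda>c. c = CHR ''#'') total_pattern {4..<11} {4..<9} = 9"
  by code_simp+

lemma paired_pattern_check:
  "pumpable 7 5 paired_pattern"
  "dominating_pattern is_arrow 7 5 paired_pattern"
  "matching_pattern 7 5 paired_pattern"
  by code_simp+

text \<open>The growth rates agree with those of the total pattern; the 7 by 5 part has 12 - 2
  vertices.\<close>

lemma paired_pattern_count:
  "block_count is_arrow paired_pattern {..<4} {..<4} = 4"
  "block_count is_arrow paired_pattern {..<4} {4..<9} = 6"
  "block_count is_arrow paired_pattern {4..<11} {..<4} = 8"
  "block_count is_arrow paired_pattern {4..<11} {4..<9} = 10"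
  by code_simp+

theorem theorem5p4:
  fixes n m :: nat
  assumes "n \<ge> 5" and "m \<ge> 5" and "m mod 4 = 1" and "n mod 4 = 3"
  shows "real (total_domination_number (cyc_prod_V n m) (cyc_prod_adj n m))
           \<le> real ((n + 1) * (m + 1)) / 4 - 3 \<and>
         real (paired_domination_number (cyc_prod_V n m) (cyc_prod_adj n m))
           \<le> real ((n + 1) * (m + 1)) / 4 - 2"
proof -
  \<comment> \<open>The residue and \<open>n \<ge> 5\<close> force \<open>n \<ge> 7\<close>, so
    neither subtraction truncates.\<close>
  define s t where "s = (n - 7) div 4" and "t = (m - 5) div 4"
  have "n = 4 * s + 7" using assms(1,4) unfolding s_def by presburger
  moreover have "m = 4 * t + 5" using assms(2,3) unfolding t_def by presburger
  moreover have fin: "finite (cyc_prod_V n m)" by (simp add: cyc_prod_V_def)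
  ultimately have
    tot: "total_domination_number (cyc_prod_V n m) (cyc_prod_adj n m) \<le> s * t * 4 + s * 6 + t * 8 + 9" and
    par: "paired_domination_number (cyc_prod_V n m) (cyc_prod_adj n m) \<le> s * t * 4 + s * 6 + t * 8 + 10"
    using total_domination_number_le[OF _ total_dominating_tiled[OF total_pattern_check refl], of s t]
      paired_domination_number_le[OF _ paired_dominating_tiled[OF paired_pattern_check refl], of s t]
      card_tiled[of "\<lambda>c. c = CHR ''#''" total_pattern s t 7 5]
      card_tiled[of is_arrow paired_pattern s t 7 5]
    by (simp_all add: total_pattern_count paired_pattern_count)
  \<comment> \<open>This is \<open>(4 * s + 8) * (4 * t + 6) / 4\<close>; its constant 12 exceeds 9
    and 10 by exactly the claimed 3 and 2.\<close>
  have "real ((n + 1) * (m + 1)) / 4 = real (s * t * 4 + s * 6 + t * 8 + 12)"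
    using \<open>n = 4 * s + 7\<close> \<open>m = 4 * t + 5\<close> by (simp add: field_simps)
  then show ?thesis using tot par by linarith
qed

end
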